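(* Let $\mathrm{MESP}(C,s)$ be an arbitrary MESP instance, i.e. $C$ is an $n\times n$ real symmetric positive-semidefinite matrix, $0<s<n$ is an integer, and $\operatorname{rank}(C)\ge s$. Let $C=\Phi\Lambda\Phi^\top$ be any real Schur decomposition of $C$, and let $\lambda_{\max}$ be the greatest eigenvalue of $C$. Put $A:=\Phi(I_n-\frac{1}{\lambda_{\max}}\Lambda)^{1/2}$ and $B:=\frac{1}{\sqrt{\lambda_{\max}}}\Lambda^{1/2}$, so that $\mathcal{D}(\mathrm{MESP}(C,s);\Phi)=\text{D-Opt}(A,B,n-s)$. Then $\mathrm{MESP}(C,s)$ is complementation equivalent to $\mathcal{D}(\mathrm{MESP}(C,s);\Phi)+s\log\lambda_{\max}$; that is, for every $S\subset N:=\{1,\dots,n\}$ with $|S|=s$, writing $T:=N\setminus S$, $$\operatorname{ldet}(C_{S,S})=\operatorname{ldet}\left(A_{T\cdot}^\top A_{T\cdot}+B^\top B\right)+s\log\lambda_{\max}.$$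
   Context: $\operatorname{ldet}$ is the natural logarithm of the determinant, with value $-\infty$ on singular positive-semidefinite matrices. $C_{S,S}$ is the principal submatrix of $C$ indexed by $S$; $A_{T\cdot}$ is the submatrix of $A$ consisting of the rows indexed by $T$. $\mathrm{MESP}(C,s)$ is the problem of maximizing $\operatorname{ldet}(C_{S,S})$ over $S\subset N$ with $|S|=s$. $\text{D-Opt}(A,B,t)$ is the problem of maximizing $\operatorname{ldet}(A_{T\cdot}^\top A_{T\cdot}+B^\top B)$ over $T\subset N$ with $|T|=t$. A real Schur decomposition of a symmetric $C$ is $C=\Phi\Lambda\Phi^\top$ with $\Phi$ orthogonal and $\Lambda$ diagonal (containing the eigenvalues). Adding a constant to a problem means adding it to its objective function. Two problems are complementation equivalent if their feasible 0/1 vectors correspond under $x\mapsto \mathbf{e}-x$ and corresponding solutions have equal objective values (after adding the stated constant). *)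

theory Defs
  imports
    "Jordan_Normal_Form.Determinant"
    "Jordan_Normal_Form.DL_Rank"
    "Jordan_Normal_Form.DL_Submatrix"
    "Jordan_Normal_Form.Spectral_Radius"
    "HOL-Library.Extended_Real"
begin

text \<open>Matrices have row and column indices \<open>0, \<dots>, n - 1\<close>, so the ground set \<open>N\<close> of an
  instance of order \<open>n\<close> is \<open>{..<n}\<close>.\<close>

definition psd :: "real mat \<Rightarrow> bool" where
  "psd M \<longleftrightarrow> square_mat M \<and> transpose_mat M = M \<and>
    (\<forall>v \<in> carrier_vec (dim_row M). 0 \<le> v \<bullet> (M *\<^sub>v v))"

text \<open>Meaningful on positive-semidefinite matrices, where the determinant is nonnegative.\<close>

definition ldet :: "real mat \<Rightarrow> ereal" where
  "ldet M = (if det M = 0 then - \<infinity> else ereal (ln (det M)))"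

definition lambda_max :: "real mat \<Rightarrow> real" where
  "lambda_max C = Max (spectrum C)"

text \<open>The library predicate \<open>orthogonal_mat\<close> only asks for pairwise orthogonal nonzero
  columns; here the columns must be orthonormal.\<close>

definition real_schur_decomposition :: "real mat \<Rightarrow> real mat \<Rightarrow> real mat \<Rightarrow> bool" where
  "real_schur_decomposition C \<Phi> \<Lambda> \<longleftrightarrow>
    \<Phi> \<in> carrier_mat (dim_row C) (dim_row C) \<and> \<Lambda> \<in> carrier_mat (dim_row C) (dim_row C) \<and>
    transpose_mat \<Phi> * \<Phi> = 1\<^sub>m (dim_row C) \<and> \<Phi> * transpose_mat \<Phi> = 1\<^sub>m (dim_row C) \<and>
    diagonal_mat \<Lambda> \<and> C = \<Phi> * \<Lambda> * transpose_mat \<Phi>"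

text \<open>The square root of a diagonal matrix with nonnegative diagonal; it is the
  positive-semidefinite square root (see the two lemmas below).\<close>

definition diag_sqrt :: "real mat \<Rightarrow> real mat" where
  "diag_sqrt M = mat_diag (dim_row M) (\<lambda>i. sqrt (M $$ (i, i)))"

lemma diag_sqrt_square:
  assumes "M \<in> carrier_mat n n" "diagonal_mat M" "\<And>i. i < n \<Longrightarrow> 0 \<le> M $$ (i, i)"
  shows "diag_sqrt M * diag_sqrt M = M"
proof -
  have "diag_sqrt M * diag_sqrt M = mat_diag n (\<lambda>i. sqrt (M $$ (i, i)) * sqrt (M $$ (i, i)))"
    using assms(1) by (simp add: diag_sqrt_def)
  also have "\<dots> = M"
    using assms by (intro eq_matI) (auto simp: mat_diag_def diagonal_mat_def)
  finally show ?thesis .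
qed

lemma psd_diag_sqrt:
  assumes "M \<in> carrier_mat n n" "\<And>i. i < n \<Longrightarrow> 0 \<le> M $$ (i, i)"
  shows "psd (diag_sqrt M)"
proof -
  have dims: "dim_row (diag_sqrt M) = n" "dim_vec (diag_sqrt M *\<^sub>v v) = n" for v
    using assms(1) by (auto simp: diag_sqrt_def mat_diag_def)
  have "0 \<le> v \<bullet> (diag_sqrt M *\<^sub>v v)" if v: "v \<in> carrier_vec n" for v
  proof -
    have "(diag_sqrt M *\<^sub>v v) $ i = sqrt (M $$ (i, i)) * v $ i" if "i < n" for i
    proof -
      have "(diag_sqrt M *\<^sub>v v) $ i
          = (\<Sum>j = 0..<n. (if i = j then sqrt (M $$ (j, j)) else 0) * v $ j)"
        using that v assms(1) by (auto simp: diag_sqrt_def mat_diag_def scalar_prod_def)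
      also have "\<dots> = (\<Sum>j = 0..<n. if i = j then sqrt (M $$ (j, j)) * v $ j else 0)"
        by (intro sum.cong) auto
      finally show ?thesis using that by simp
    qed
    then have "v \<bullet> (diag_sqrt M *\<^sub>v v) = (\<Sum>i = 0..<n. sqrt (M $$ (i, i)) * (v $ i)\<^sup>2)"
      using assms(1) dims unfolding scalar_prod_def
      by (intro sum.cong) (auto simp: power2_eq_square simp del: index_mult_mat_vec)
    then show ?thesis using assms(2) by (auto intro!: sum_nonneg)
  qed
  moreover have "transpose_mat (diag_sqrt M) = diag_sqrt M"
    by (intro eq_matI) (auto simp: diag_sqrt_def mat_diag_def)
  ultimately show ?thesis
    using assms(1) dims by (auto simp: psd_def diag_sqrt_def mat_diag_def)
qed

text \<open>A maximization problem over subsets of the ground set, which stand for their 0/1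
  characteristic vectors.\<close>

record subset_problem =
  feasible :: "nat set set"
  objective :: "nat set \<Rightarrow> ereal"

definition add_const :: "subset_problem \<Rightarrow> real \<Rightarrow> subset_problem" where
  "add_const P c = P\<lparr>objective := (\<lambda>S. objective P S + ereal c)\<rparr>"

definition MESP :: "real mat \<Rightarrow> nat \<Rightarrow> subset_problem" where
  "MESP C s = \<lparr>
    feasible = {S. S \<subseteq> {..<dim_row C} \<and> card S = s},
    objective = (\<lambda>S. ldet (submatrix C S S))\<rparr>"

definition D_Opt :: "real mat \<Rightarrow> real mat \<Rightarrow> nat \<Rightarrow> subset_problem" where
  "D_Opt A B t = \<lparr>
    feasible = {T. T \<subseteq> {..<dim_row A} \<and> card T = t},
    objective = (\<lambda>T. ldet (transpose_mat (submatrix A T UNIV) * submatrix A T UNIV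
                          + transpose_mat B * B))\<rparr>"

text \<open>The problem \<open>\<D>(MESP(C,s); \<Phi>)\<close>. In a Schur decomposition \<open>C = \<Phi> \<Lambda> \<Phi>\<^sup>T\<close> the diagonal factor
  is determined by \<open>C\<close> and \<open>\<Phi>\<close>, namely \<open>\<Lambda> = \<Phi>\<^sup>T C \<Phi>\<close>.\<close>

definition D_of_MESP :: "real mat \<Rightarrow> nat \<Rightarrow> real mat \<Rightarrow> subset_problem" where
  "D_of_MESP C s \<Phi> =
    (let n = dim_row C; \<Lambda> = transpose_mat \<Phi> * C * \<Phi>; l = lambda_max C
     in D_Opt (\<Phi> * diag_sqrt (1\<^sub>m n - (1 / l) \<cdot>\<^sub>m \<Lambda>)) ((1 / sqrt l) \<cdot>\<^sub>m diag_sqrt \<Lambda>) (n - s))"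

definition char_vec :: "nat \<Rightarrow> nat set \<Rightarrow> real vec" where
  "char_vec n S = vec n (\<lambda>i. if i \<in> S then 1 else 0)"

definition ones_vec :: "nat \<Rightarrow> real vec" where
  "ones_vec n = vec n (\<lambda>_. 1)"

definition complementation_equivalent :: "nat \<Rightarrow> subset_problem \<Rightarrow> subset_problem \<Rightarrow> bool" where
  "complementation_equivalent n P Q \<longleftrightarrow>
    (\<lambda>x. ones_vec n - x) ` char_vec n ` feasible P = char_vec n ` feasible Q \<and>
    (\<forall>S \<in> feasible P. \<forall>T \<in> feasible Q.
      char_vec n T = ones_vec n - char_vec n S \<longrightarrow> objective P S = objective Q T)"

end

theory Submission
  imports Defs
begin

text \<open>Since \<open>A\<^sup>T A + B\<^sup>T B = I\<close>, removing the rows in \<open>S = N \<setminus> T\<close> gives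
  \<open>A\<^sub>T\<^sup>T A\<^sub>T + B\<^sup>T B = I - A\<^sub>S\<^sup>T A\<^sub>S\<close>. By Sylvester's identity its determinant equals that of
  \<open>I - A\<^sub>S A\<^sub>S\<^sup>T\<close>, which is the principal submatrix of \<open>I - A A\<^sup>T = C / \<lambda>\<^sub>m\<^sub>a\<^sub>x\<close> indexed by \<open>S\<close>.\<close>

section \<open>Sylvester's determinant identity\<close>

lemma det_one_minus_mult_commute:
  fixes X Y :: "'a :: idom mat"
  assumes X: "X \<in> carrier_mat m n" and Y: "Y \<in> carrier_mat n m"
  shows "det (1\<^sub>m m - X * Y) = det (1\<^sub>m n - Y * X)"
proof -
  \<comment> \<open>Both determinants equal that of \<open>?M\<close>. The factors \<open>?L\<close>
    and \<open>?U\<close> are block triangular with identity blocks on the diagonal, so they have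
    determinant 1. Multiplying by \<open>?L\<close> on the right clears the lower left block of
    \<open>?M\<close> and leaves the Schur complement \<open>1 - X * Y\<close>. Multiplying by
    \<open>?U\<close> clears the upper right block and leaves \<open>1 - Y * X\<close>.\<close>
  let ?M = "four_block_mat (1\<^sub>m m) X Y (1\<^sub>m n)"
  let ?L = "four_block_mat (1\<^sub>m m) (0\<^sub>m m n) (- Y) (1\<^sub>m n)"
  let ?U = "four_block_mat (1\<^sub>m m) (- X) (0\<^sub>m n m) (1\<^sub>m n)"
  have XY: "1\<^sub>m m - X * Y \<in> carrier_mat m m" and YX: "1\<^sub>m n - Y * X \<in> carrier_mat n n"
    using X Y by auto
  have M: "?M \<in> carrier_mat (m + n) (m + n)" and L: "?L \<in> carrier_mat (m + n) (m + n)"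
    and U: "?U \<in> carrier_mat (m + n) (m + n)"
    by auto
  have "?M * ?L = four_block_mat (1\<^sub>m m - X * Y) X (0\<^sub>m n m) (1\<^sub>m n)"
    using X Y by (subst mult_four_block_mat[of _ m m _ n _ n _ _ m _ n])
      (auto simp: minus_add_uminus_mat[of "1\<^sub>m m" m m])
  then have "det ?M * det ?L = det (1\<^sub>m m - X * Y)"
    using X by (simp add: det_mult[OF M L, symmetric]
        det_four_block_mat_lower_left_zero[OF XY])
  moreover have "det ?L = 1"
    using Y by (subst det_four_block_mat_upper_right_zero[of _ m _ n]) auto
  moreover have "?M * ?U = four_block_mat (1\<^sub>m m) (0\<^sub>m m n) Y (1\<^sub>m n - Y * X)"
    using X Y by (subst mult_four_block_mat[of _ m m _ n _ n _ _ m _ n])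
      (auto simp: minus_add_uminus_mat[of "1\<^sub>m n" n n] comm_add_mat[of "1\<^sub>m n" n n])
  then have "det ?M * det ?U = det (1\<^sub>m n - Y * X)"
    using Y by (simp add: det_mult[OF M U, symmetric]
        det_four_block_mat_upper_right_zero[OF _ refl _ YX])
  moreover have "det ?U = 1"
    using X by (subst det_four_block_mat_lower_left_zero[of _ m _ n]) auto
  ultimately show ?thesis by simp
qed

section \<open>Submatrices and Gram matrices of selected rows\<close>

text \<open>Strict monotonicity of \<open>pick I\<close> gives injectivity, and counting then gives
  surjectivity. This turns sums over row positions of a submatrix into sums over the index set
  itself.\<close>

lemma bij_betw_pick:
  assumes "finite I"
  shows "bij_betw (pick I) {..<card I} I"
proof -
  have inj: "inj_on (pick I) {..<card I}"
    using assms pick_mono_le[of _ I] by (intro linorder_inj_onI) (auto simp: less_imp_neq)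
  moreover have "pick I ` {..<card I} \<subseteq> I"
    by (auto intro: pick_in_set_le)
  ultimately show ?thesis
    using assms by (simp add: bij_betw_def card_image card_subset_eq)
qed

lemma Collect_less_subset: "I \<subseteq> {..<n} \<Longrightarrow> {i. i < n \<and> i \<in> I} = I"
  for n :: nat
  by auto

context
  fixes M :: "'a :: comm_ring_1 mat" and n m :: nat and I :: "nat set"
  assumes M: "M \<in> carrier_mat n m" and I: "I \<subseteq> {..<n}"
begin

lemma submatrix_rows_carrier: "submatrix M I UNIV \<in> carrier_mat (card I) m"
  using M by (auto simp: dim_submatrix Collect_less_subset[OF I])

lemma submatrix_rows_index:
  "i < card I \<Longrightarrow> j < m \<Longrightarrow> submatrix M I UNIV $$ (i, j) = M $$ (pick I i, j)"
  using M by (subst submatrix_index) (auto simp: Collect_less_subset[OF I] pick_UNIV)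

text \<open>The enumeration \<open>pick I\<close> disappears from the right-hand side, so the
  entries for disjoint row sets can be added.\<close>

lemma gram_submatrix_rows_index:
  assumes "i < m" "j < m"
  shows "(transpose_mat (submatrix M I UNIV) * submatrix M I UNIV) $$ (i, j)
    = (\<Sum>t\<in>I. M $$ (t, i) * M $$ (t, j))"
proof -
  have "(transpose_mat (submatrix M I UNIV) * submatrix M I UNIV) $$ (i, j)
      = (\<Sum>k<card I. M $$ (pick I k, i) * M $$ (pick I k, j))"
    using assms submatrix_rows_carrier
    by (auto simp: scalar_prod_def submatrix_rows_index atLeast0LessThan intro!: sum.cong)
  also have "\<dots> = (\<Sum>t\<in>I. M $$ (t, i) * M $$ (t, j))"
    using I finite_subset[OF I]
    by (intro sum.reindex_bij_betw[of "pick I"] bij_betw_pick) auto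
  finally show ?thesis .
qed

end

text \<open>A Gram matrix is the sum of the rank-one contributions of its rows, so it splits along
  any partition of the rows.\<close>

lemma gram_submatrix_rows_complement:
  fixes M :: "'a :: comm_ring_1 mat"
  assumes M: "M \<in> carrier_mat n m" and I: "I \<subseteq> {..<n}"
  shows "transpose_mat (submatrix M I UNIV) * submatrix M I UNIV
    + transpose_mat (submatrix M ({..<n} - I) UNIV) * submatrix M ({..<n} - I) UNIV
    = transpose_mat M * M"
  (is "?G I + ?G ?J = _")
proof (rule eq_matI)
  fix i j
  assume "i < dim_row (transpose_mat M * M)" "j < dim_col (transpose_mat M * M)"
  then have ij: "i < m" "j < m"
    using M by auto
  have J: "?J \<subseteq> {..<n}"
    by auto
  have "(?G I + ?G ?J) $$ (i, j)
      = (\<Sum>t\<in>I. M $$ (t, i) * M $$ (t, j)) + (\<Sum>t\<in>?J. M $$ (t, i) * M $$ (t, j))"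
    using ij carrier_matD[OF submatrix_rows_carrier[OF M I]]
      carrier_matD[OF submatrix_rows_carrier[OF M J]]
    by (simp add: gram_submatrix_rows_index[OF M I ij] gram_submatrix_rows_index[OF M J ij]
        del: index_mult_mat(1))
  also have "\<dots> = (\<Sum>t<n. M $$ (t, i) * M $$ (t, j))"
    using I by (simp add: sum.subset_diff[of I "{..<n}"] add.commute)
  also have "\<dots> = (transpose_mat M * M) $$ (i, j)"
    using M ij by (auto simp: scalar_prod_def atLeast0LessThan intro!: sum.cong)
  finally show "(?G I + ?G ?J) $$ (i, j) = (transpose_mat M * M) $$ (i, j)" .
qed (use M submatrix_rows_carrier[OF M I] submatrix_rows_carrier[OF M, of "{..<n} - I"] in auto)

lemma submatrix_principal_carrier:
  assumes M: "M \<in> carrier_mat n n" and I: "I \<subseteq> {..<n}"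
  shows "submatrix M I I \<in> carrier_mat (card I) (card I)"
  by (rule carrier_matI) (simp_all add: dim_submatrix carrier_matD[OF M] Collect_less_subset[OF I])

text \<open>On both sides the entry at \<open>(i, j)\<close> is the inner product of the rows
  \<open>pick I i\<close> and \<open>pick I j\<close> of \<open>M\<close>.\<close>

lemma submatrix_rows_mult_transpose:
  fixes M :: "'a :: comm_ring_1 mat"
  assumes M: "M \<in> carrier_mat n m" and I: "I \<subseteq> {..<n}"
  shows "submatrix M I UNIV * transpose_mat (submatrix M I UNIV) = submatrix (M * transpose_mat M) I I"
proof (rule eq_matI)
  have dims: "dim_row (submatrix (M * transpose_mat M) I I) = card I"
    "dim_col (submatrix (M * transpose_mat M) I I) = card I"
    using M by (simp_all add: dim_submatrix Collect_less_subset[OF I])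
  show "dim_row (submatrix M I UNIV * transpose_mat (submatrix M I UNIV))
      = dim_row (submatrix (M * transpose_mat M) I I)"
    "dim_col (submatrix M I UNIV * transpose_mat (submatrix M I UNIV))
      = dim_col (submatrix (M * transpose_mat M) I I)"
    using dims submatrix_rows_carrier[OF M I] by auto
  fix i j
  assume "i < dim_row (submatrix (M * transpose_mat M) I I)"
    "j < dim_col (submatrix (M * transpose_mat M) I I)"
  then have ij: "i < card I" "j < card I"
    using dims by auto
  then have "pick I i < n" "pick I j < n"
    using I pick_in_set_le by blast+
  moreover have "submatrix (M * transpose_mat M) I I $$ (i, j)
      = (M * transpose_mat M) $$ (pick I i, pick I j)"
    using M ij by (subst submatrix_index) (auto simp: Collect_less_subset[OF I])
  ultimately show "(submatrix M I UNIV * transpose_mat (submatrix M I UNIV)) $$ (i, j)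
      = submatrix (M * transpose_mat M) I I $$ (i, j)"
    using M ij submatrix_rows_carrier[OF M I]
    by (simp add: scalar_prod_def submatrix_rows_index[OF M I])
qed

text \<open>The identity matrix restricts to an identity matrix because \<open>pick I\<close> is
  injective below \<open>card I\<close>: off-diagonal positions come from off-diagonal
  positions.\<close>

lemma submatrix_one_minus_smult:
  fixes M :: "'a :: comm_ring_1 mat"
  assumes M: "M \<in> carrier_mat n n" and I: "I \<subseteq> {..<n}"
  shows "submatrix (1\<^sub>m n - c \<cdot>\<^sub>m M) I I = 1\<^sub>m (card I) - c \<cdot>\<^sub>m submatrix M I I"
proof (rule eq_matI)
  have inj: "inj_on (pick I) {..<card I}"
    using bij_betw_pick[of I] I finite_subset by (auto simp: bij_betw_def)
  fix i j
  assume "i < dim_row (1\<^sub>m (card I) - c \<cdot>\<^sub>m submatrix M I I)"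
    "j < dim_col (1\<^sub>m (card I) - c \<cdot>\<^sub>m submatrix M I I)"
  then have ij: "i < card I" "j < card I"
    using M by (auto simp: dim_submatrix Collect_less_subset[OF I])
  then have "pick I i < n" "pick I j < n"
    using I pick_in_set_le by blast+
  moreover have "pick I i = pick I j \<longleftrightarrow> i = j"
    using inj ij by (auto simp: inj_on_eq_iff)
  ultimately show "submatrix (1\<^sub>m n - c \<cdot>\<^sub>m M) I I $$ (i, j)
      = (1\<^sub>m (card I) - c \<cdot>\<^sub>m submatrix M I I) $$ (i, j)"
    using M ij by (simp add: submatrix_def Collect_less_subset[OF I])
qed (use M in \<open>simp_all add: dim_submatrix Collect_less_subset[OF I]\<close>)

lemma add_eq_imp_eq_minus_mat:
  fixes X Y Z :: "'a :: ab_group_add mat"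
  assumes "X \<in> carrier_mat nr nc" "Y \<in> carrier_mat nr nc" "X + Y = Z"
  shows "Y = Z - X"
  unfolding assms(3)[symmetric] using assms(1,2) by (intro eq_matI) auto

section \<open>The determinant identity for complementary row sets\<close>

text \<open>The hypotheses on \<open>A\<close> act on the two sides of Sylvester's identity:
  \<open>columns\<close> trades the rows outside \<open>S\<close> for those inside, in order
  \<open>n\<close>, and \<open>rows\<close> evaluates the resulting matrix of order
  \<open>card S\<close>. The power of \<open>c\<close> is the scalar pulled out of a determinant of
  that order.\<close>

lemma det_gram_complement:
  fixes A B C :: "'a :: idom mat"
  assumes A: "A \<in> carrier_mat n n" and B: "B \<in> carrier_mat k n" and C: "C \<in> carrier_mat n n"
    and columns: "transpose_mat A * A + transpose_mat B * B = 1\<^sub>m n"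
    and rows: "A * transpose_mat A = 1\<^sub>m n - c \<cdot>\<^sub>m C"
    and S: "S \<subseteq> {..<n}"
  shows "det (transpose_mat (submatrix A ({..<n} - S) UNIV) * submatrix A ({..<n} - S) UNIV
      + transpose_mat B * B) = c ^ card S * det (submatrix C S S)"
proof -
  let ?AS = "submatrix A S UNIV" and ?AT = "submatrix A ({..<n} - S) UNIV"
  let ?GS = "transpose_mat ?AS * ?AS" and ?GT = "transpose_mat ?AT * ?AT"
  have AS: "?AS \<in> carrier_mat (card S) n"
    using submatrix_rows_carrier[OF A S] .
  have GT: "?GT \<in> carrier_mat n n"
    using submatrix_rows_carrier[OF A, of "{..<n} - S"] by auto
  have GS: "?GS \<in> carrier_mat n n" and BB: "transpose_mat B * B \<in> carrier_mat n n"
    using AS B by auto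
  have CS: "submatrix C S S \<in> carrier_mat (card S) (card S)"
    using submatrix_principal_carrier[OF C S] .
  have "?GS + (?GT + transpose_mat B * B) = 1\<^sub>m n"
    unfolding assoc_add_mat[OF GS GT BB, symmetric] gram_submatrix_rows_complement[OF A S]
    by (fact columns)
  then have "?GT + transpose_mat B * B = 1\<^sub>m n - ?GS"
    by (rule add_eq_imp_eq_minus_mat[OF GS add_carrier_mat[OF BB]])
  then have "det (?GT + transpose_mat B * B) = det (1\<^sub>m (card S) - ?AS * transpose_mat ?AS)"
    using det_one_minus_mult_commute[OF AS, of "transpose_mat ?AS"] AS by simp
  also have "?AS * transpose_mat ?AS = 1\<^sub>m (card S) - c \<cdot>\<^sub>m submatrix C S S"
    by (simp add: submatrix_rows_mult_transpose[OF A S] rows submatrix_one_minus_smult[OF C S])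
  also have "1\<^sub>m (card S) - \<dots> = c \<cdot>\<^sub>m submatrix C S S"
    using CS by (intro eq_matI) auto
  finally show ?thesis
    using CS by simp
qed

text \<open>Since \<open>c\<close> is positive, \<open>G\<close> and \<open>M\<close> are singular
  together, and then both sides are minus infinity, which absorbs the real summand. Otherwise the
  factor \<open>(1 / c) ^ k\<close> contributes \<open>- k * ln c\<close> to the logarithm; a
  negative \<open>det M\<close> is covered too, as real \<open>ln\<close> splits off a positive
  factor there as well.\<close>

lemma ldet_smult_add:
  assumes "M \<in> carrier_mat k k" "0 < c"
    and "det G = (1 / c) ^ k * det M"
  shows "ldet M = ldet G + ereal (real k * ln c)"
  using assms by (auto simp: ldet_def ln_mult ln_realpow ln_div)

section \<open>Spectral consequences of the Schur decomposition\<close>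

lemma real_schur_decompositionD:
  assumes "C \<in> carrier_mat n n" "real_schur_decomposition C \<Phi> \<Lambda>"
  shows "\<Phi> \<in> carrier_mat n n" "\<Lambda> \<in> carrier_mat n n"
    "transpose_mat \<Phi> * \<Phi> = 1\<^sub>m n" "\<Phi> * transpose_mat \<Phi> = 1\<^sub>m n"
    "diagonal_mat \<Lambda>" "C = \<Phi> * \<Lambda> * transpose_mat \<Phi>"
  using assms by (auto simp: real_schur_decomposition_def)

text \<open>The first equation matches the \<Lambda> given in the theorem with the one that
  \<open>D_of_MESP\<close> computes from \<open>C\<close> and \<Phi>. The second is the eigenvector
  equation for all columns of \<Phi> at once.\<close>

lemma real_schur_decomposition_diagonal_factor:
  assumes C: "C \<in> carrier_mat n n" and dec: "real_schur_decomposition C \<Phi> \<Lambda>"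
  shows "transpose_mat \<Phi> * C * \<Phi> = \<Lambda>" "C * \<Phi> = \<Phi> * \<Lambda>"
proof -
  note d = real_schur_decompositionD[OF C dec]
  have "C * \<Phi> = \<Phi> * \<Lambda> * (transpose_mat \<Phi> * \<Phi>)"
    unfolding d(6) using d(1,2) by (intro assoc_mult_mat) auto
  then show C\<Phi>: "C * \<Phi> = \<Phi> * \<Lambda>"
    using d(1,2,3) by simp
  have "transpose_mat \<Phi> * C * \<Phi> = transpose_mat \<Phi> * (C * \<Phi>)"
    using d(1) C by (intro assoc_mult_mat) auto
  also have "\<dots> = transpose_mat \<Phi> * \<Phi> * \<Lambda>"
    unfolding C\<Phi> using d(1,2) by (intro assoc_mult_mat[symmetric]) auto
  finally show "transpose_mat \<Phi> * C * \<Phi> = \<Lambda>"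
    using d(2,3) by simp
qed

lemma diagonal_mat_eq_mat_diag:
  assumes "D \<in> carrier_mat n n" "diagonal_mat D"
  shows "D = mat_diag n (\<lambda>i. D $$ (i, i))"
  using assms by (intro eq_matI) (auto simp: mat_diag_def diagonal_mat_def)

text \<open>Right multiplication by a diagonal matrix scales columns, so comparing the columns with
  index \<open>i\<close> in \<open>C * \<Phi> = \<Phi> * \<Lambda>\<close> gives the eigenvector
  equation. Orthonormality excludes the zero vector.\<close>

lemma real_schur_decomposition_eigenvalue:
  assumes C: "C \<in> carrier_mat n n" and dec: "real_schur_decomposition C \<Phi> \<Lambda>" and i: "i < n"
  shows "col \<Phi> i \<in> carrier_vec n" "col \<Phi> i \<bullet> col \<Phi> i = 1"
    "C *\<^sub>v col \<Phi> i = \<Lambda> $$ (i, i) \<cdot>\<^sub>v col \<Phi> i" "\<Lambda> $$ (i, i) \<in> spectrum C"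
proof -
  note d = real_schur_decompositionD[OF C dec]
  show v: "col \<Phi> i \<in> carrier_vec n"
    using d(1) i by simp
  have "(transpose_mat \<Phi> * \<Phi>) $$ (i, i) = 1"
    using d(3) i by simp
  then show unit: "col \<Phi> i \<bullet> col \<Phi> i = 1"
    using d(1) i by simp
  have "C *\<^sub>v col \<Phi> i = col (\<Phi> * mat_diag n (\<lambda>i. \<Lambda> $$ (i, i))) i"
    using real_schur_decomposition_diagonal_factor(2)[OF C dec]
      diagonal_mat_eq_mat_diag[OF d(2,5)] C d(1) i by (metis col_mult2)
  then show eig: "C *\<^sub>v col \<Phi> i = \<Lambda> $$ (i, i) \<cdot>\<^sub>v col \<Phi> i"
    using d(1) i by (subst (asm) mat_diag_mult_right[of _ n n]) (auto simp: mult.commute)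
  have "col \<Phi> i \<noteq> 0\<^sub>v n"
    using unit by auto
  then show "\<Lambda> $$ (i, i) \<in> spectrum C"
    using v eig C by (auto simp: spectrum_def eigenvalue_def eigenvector_def)
qed

text \<open>The diagonal entry is the value of the quadratic form of \<open>C\<close> at a unit
  eigenvector, hence nonnegative; being in the finite spectrum, it is at most the maximum. The two
  bounds make the arguments of both square roots, in \<open>B\<close> and in \<open>A\<close>,
  nonnegative.\<close>

lemma real_schur_decomposition_bounds:
  assumes C: "C \<in> carrier_mat n n" and dec: "real_schur_decomposition C \<Phi> \<Lambda>"
    and "psd C" and i: "i < n"
  shows "0 \<le> \<Lambda> $$ (i, i)" "\<Lambda> $$ (i, i) \<le> lambda_max C"
proof -
  note e = real_schur_decomposition_eigenvalue[OF C dec i]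
  have "0 \<le> col \<Phi> i \<bullet> (C *\<^sub>v col \<Phi> i)"
    using \<open>psd C\<close> C e(1) by (auto simp: psd_def)
  then show "0 \<le> \<Lambda> $$ (i, i)"
    unfolding e(3) using e(1,2) by simp
  show "\<Lambda> $$ (i, i) \<le> lambda_max C"
    using e(4) card_finite_spectrum(1)[OF C] by (simp add: lambda_max_def)
qed

text \<open>Otherwise the bounds squeeze every diagonal entry of \<Lambda> to 0, so \<open>C\<close>
  vanishes and has rank 0. Positivity is what justifies dividing by \<open>lambda_max C\<close> and
  taking its logarithm.\<close>

lemma lambda_max_pos:
  assumes C: "C \<in> carrier_mat n n" and dec: "real_schur_decomposition C \<Phi> \<Lambda>"
    and psd: "psd C" and rank: "0 < vec_space.rank n C"
  shows "0 < lambda_max C"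
proof (rule ccontr)
  assume neg: "\<not> 0 < lambda_max C"
  note d = real_schur_decompositionD[OF C dec]
  have "\<Lambda> $$ (i, i) = 0" if "i < n" for i
    using real_schur_decomposition_bounds[OF C dec psd that] neg by auto
  then have "\<Lambda> = 0\<^sub>m n n"
    using d(2,5) by (intro eq_matI) (auto simp: diagonal_mat_def)
  then have "C = 0\<^sub>m n n"
    using d(1,6) by simp
  then show False
    using rank vec_space.rank_0I[of n n, where ?'a = real] by simp
qed

section \<open>Characteristic vectors and complements\<close>

text \<open>Complementation equivalence pairs solutions through their vectors; this brings the
  pairing back to sets.\<close>

lemma char_vec_eq_iff:
  assumes "S \<subseteq> {..<n}" "T \<subseteq> {..<n}"
  shows "char_vec n S = char_vec n T \<longleftrightarrow> S = T"
proof
  assume eq: "char_vec n S = char_vec n T"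
  have "i \<in> S \<longleftrightarrow> i \<in> T" if "i < n" for i
    using arg_cong[OF eq, of "\<lambda>v. v $ i"] that by (simp add: char_vec_def split: if_splits)
  then show "S = T"
    using assms by auto
qed simp

lemma ones_minus_char_vec: "ones_vec n - char_vec n S = char_vec n ({..<n} - S)"
  by (intro eq_vecI) (auto simp: ones_vec_def char_vec_def)

theorem theorem10:
  fixes C \<Phi> \<Lambda> A B :: "real mat" and n s :: nat
  assumes "C \<in> carrier_mat n n"
    and "psd C"
    and "0 < s" and "s < n"
    and "s \<le> vec_space.rank n C"
    and "real_schur_decomposition C \<Phi> \<Lambda>"
    and "A = \<Phi> * diag_sqrt (1\<^sub>m n - (1 / lambda_max C) \<cdot>\<^sub>m \<Lambda>)"
    and "B = (1 / sqrt (lambda_max C)) \<cdot>\<^sub>m diag_sqrt \<Lambda>"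
  shows "D_of_MESP C s \<Phi> = D_Opt A B (n - s)
    \<and> complementation_equivalent n (MESP C s)
        (add_const (D_of_MESP C s \<Phi>) (real s * ln (lambda_max C)))
    \<and> (\<forall>S T. S \<subseteq> {..<n} \<longrightarrow> card S = s \<longrightarrow> T = {..<n} - S \<longrightarrow>
        ldet (submatrix C S S)
          = ldet (transpose_mat (submatrix A T UNIV) * submatrix A T UNIV + transpose_mat B * B)
            + ereal (real s * ln (lambda_max C)))"
proof -
  define l where "l = lambda_max C"
  define E where "E = diag_sqrt (1\<^sub>m n - (1 / l) \<cdot>\<^sub>m \<Lambda>)"
  note C = assms(1)
  note d = real_schur_decompositionD[OF C assms(6)]
  have l: "0 < l"
    using lambda_max_pos[OF C assms(6,2)] assms(3,5) by (simp add: l_def)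
  note bounds = real_schur_decomposition_bounds[OF C assms(6,2), folded l_def]
  have E: "E \<in> carrier_mat n n"
    using d(2) by (auto simp: E_def diag_sqrt_def)
  have E_sym: "transpose_mat E = E"
    by (intro eq_matI) (auto simp: E_def diag_sqrt_def mat_diag_def)
  \<comment> \<open>The upper bound on the eigenvalues makes the diagonal of
    \<open>1 - \<Lambda> / l\<close> nonnegative, so its \<open>diag_sqrt\<close> is a true
    root.\<close>
  have EE: "E * E = 1\<^sub>m n - (1 / l) \<cdot>\<^sub>m \<Lambda>"
    unfolding E_def using d(2,5) l bounds
    by (intro diag_sqrt_square) (auto simp: diagonal_mat_def)
  have A_eq: "A = \<Phi> * E"
    using assms(7) by (simp add: E_def l_def)
  have A: "A \<in> carrier_mat n n" and At: "transpose_mat A = E * transpose_mat \<Phi>"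
    using d(1) E by (auto simp: A_eq transpose_mult[of _ n n] E_sym)
  have R: "diag_sqrt \<Lambda> \<in> carrier_mat n n"
    and R_sym: "transpose_mat (diag_sqrt \<Lambda>) = diag_sqrt \<Lambda>"
    using d(2) by (auto simp: diag_sqrt_def mat_diag_def intro!: eq_matI)
  have B: "B \<in> carrier_mat n n"
    using assms(8) R by simp
  \<comment> \<open>In this order the orthogonal factors meet in the middle and cancel, leaving a
    diagonal matrix that complements \<open>transpose_mat B * B\<close> to the identity.\<close>
  have "transpose_mat A * A = E * (transpose_mat \<Phi> * \<Phi>) * E"
    using d(1) E by (simp add: At) (simp add: A_eq assoc_mult_mat[of _ n n _ n _ n])
  then have AtA: "transpose_mat A * A = 1\<^sub>m n - (1 / l) \<cdot>\<^sub>m \<Lambda>"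
    using d(3) E EE by simp
  \<comment> \<open>The symmetry of the root is inserted on the right-hand side only; both sides are
    then transposes and agree entrywise.\<close>
  have "transpose_mat B = (1 / sqrt l) \<cdot>\<^sub>m diag_sqrt \<Lambda>"
    unfolding assms(8) l_def[symmetric] by (subst (2) R_sym[symmetric]) (intro eq_matI; simp)
  then have "transpose_mat B * B = (1 / sqrt l * (1 / sqrt l)) \<cdot>\<^sub>m (diag_sqrt \<Lambda> * diag_sqrt \<Lambda>)"
    using assms(8) R by (intro eq_matI) (auto simp: l_def)
  also have "\<dots> = (1 / l) \<cdot>\<^sub>m \<Lambda>"
    using diag_sqrt_square[OF d(2,5)] bounds l by simp
  finally have BtB: "transpose_mat B * B = (1 / l) \<cdot>\<^sub>m \<Lambda>" .
  have columns: "transpose_mat A * A + transpose_mat B * B = 1\<^sub>m n"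
    unfolding AtA BtB using d(2) by (intro eq_matI) auto
  \<comment> \<open>In the opposite order \<Phi> stays outside, and conjugating \<Lambda> by it
    restores \<open>C\<close>.\<close>
  have "A * transpose_mat A = \<Phi> * (E * E) * transpose_mat \<Phi>"
    using d(1) E by (simp add: At) (simp add: A_eq assoc_mult_mat[of _ n n _ n _ n])
  also have "\<dots> = \<Phi> * transpose_mat \<Phi> - (1 / l) \<cdot>\<^sub>m (\<Phi> * \<Lambda> * transpose_mat \<Phi>)"
    using d(1,2) unfolding EE
    by (simp add: mult_minus_distrib_mat[of _ n n _ n] mult_smult_distrib[of _ n n _ n]
        minus_mult_distrib_mat[of _ n n _ _ n] mult_smult_assoc_mat[of _ n n _ n])
  finally have rows: "A * transpose_mat A = 1\<^sub>m n - (1 / l) \<cdot>\<^sub>m C"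
    using d(4,6) by simp
  \<comment> \<open>The determinant identity is applied with \<open>c = 1 / l\<close>; its factor
    \<open>(1 / l) ^ s\<close> accounts for the constant \<open>s * ln l\<close>.\<close>
  have identity: "ldet (submatrix C S S)
      = ldet (transpose_mat (submatrix A ({..<n} - S) UNIV) * submatrix A ({..<n} - S) UNIV
          + transpose_mat B * B) + ereal (real s * ln l)"
    if S: "S \<subseteq> {..<n}" "card S = s" for S
  proof (rule ldet_smult_add)
    show "submatrix C S S \<in> carrier_mat s s"
      using submatrix_principal_carrier[OF C S(1)] S(2) by simp
  qed (use l det_gram_complement[OF A B C columns rows S(1)] S(2) in auto)
  have D: "D_of_MESP C s \<Phi> = D_Opt A B (n - s)"
    using C real_schur_decomposition_diagonal_factor(1)[OF C assms(6)] assms(7,8)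
    by (simp add: D_of_MESP_def Let_def)
  \<comment> \<open>Subtraction on naturals truncates: \<open>n - card S = n - s\<close> forces
    \<open>card S = s\<close> only because neither number exceeds \<open>n\<close>.\<close>
  have feasible_iff: "{..<n} - S \<in> feasible (D_Opt A B (n - s)) \<longleftrightarrow> S \<in> feasible (MESP C s)"
    if "S \<subseteq> {..<n}" for S
  proof -
    have "card S \<le> n"
      using card_mono[OF _ that] by simp
    then show ?thesis
      using that A C assms(4) finite_subset[OF that]
      by (auto simp: MESP_def D_Opt_def card_Diff_subset)
  qed
  have feasible_D: "feasible (D_Opt A B (n - s)) = (\<lambda>S. {..<n} - S) ` feasible (MESP C s)"
  proof (intro subset_antisym subsetI)
    \<comment> \<open>Complementation is an involution on subsets of the ground set, so the preimage
      of \<open>T\<close> is its own complement in \<open>{..<n}\<close>.\<close>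
    fix T assume T: "T \<in> feasible (D_Opt A B (n - s))"
    then have "{..<n} - ({..<n} - T) = T"
      using A by (auto simp: D_Opt_def)
    then show "T \<in> (\<lambda>S. {..<n} - S) ` feasible (MESP C s)"
      using T feasible_iff[of "{..<n} - T"] by (metis Diff_subset imageI)
  qed (use feasible_iff C in \<open>auto simp: MESP_def\<close>)
  have "complementation_equivalent n (MESP C s) (add_const (D_of_MESP C s \<Phi>) (real s * ln l))"
    unfolding complementation_equivalent_def
  proof (intro conjI ballI impI)
    show "(\<lambda>x. ones_vec n - x) ` char_vec n ` feasible (MESP C s)
        = char_vec n ` feasible (add_const (D_of_MESP C s \<Phi>) (real s * ln l))"
      by (simp add: D add_const_def feasible_D image_image ones_minus_char_vec)
  next
    fix S T
    assume "S \<in> feasible (MESP C s)"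
      and T: "T \<in> feasible (add_const (D_of_MESP C s \<Phi>) (real s * ln l))"
      and eq: "char_vec n T = ones_vec n - char_vec n S"
    then have S: "S \<subseteq> {..<n}" "card S = s"
      using C by (auto simp: MESP_def)
    have "T \<subseteq> {..<n}"
      using T A by (auto simp: D add_const_def D_Opt_def)
    \<comment> \<open>The vector equation determines \<open>T\<close> from \<open>S\<close>, so the
      identity for complementary sets covers every matched pair.\<close>
    then have "T = {..<n} - S"
      using eq by (simp add: ones_minus_char_vec char_vec_eq_iff)
    then show "objective (MESP C s) S
        = objective (add_const (D_of_MESP C s \<Phi>) (real s * ln l)) T"
      using identity[OF S] by (simp add: D add_const_def MESP_def D_Opt_def)
  qed
  then show ?thesis
    using D identity by (simp add: l_def)
qed

end
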